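(* Let $\omega^1,\omega^2,\omega^3,\omega^4$ be four independent samples, each $\omega^r = (X_{r,k})_{k\ge 1}$ being a sequence of independent Poisson random variables with $\mathbb{E} X_{r,k} = 1/k$. Then with positive probability the intersection $\bigcap_{r=1}^4 S(\omega^r)$ contains no positive integer.
   Context: For a sequence $\omega = (X_k)_{k \geq 1}$ of nonnegative integers, the sumset is $$S(\omega) := \left\{ \sum_{k\ge 1} a_k\, k : a_k \in \mathbb{Z}_{\ge 0},\ a_k \leq X_k \text{ for all } k,\ a_k = 0 \text{ for all but finitely many } k \right\},$$ i.e. the set of all sums of finite sub-multisets of the multiset containing $X_k$ copies of each positive integer $k$. *)

theory Defs
  imports "HOL-Probability.Probability"
begin

(* The multiplicity sequence is indexed by the positive integers; the value of the
   function at 0 is ignored. *)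
definition sumset :: "(nat \<Rightarrow> nat) \<Rightarrow> nat set" where
  "sumset \<omega> = {(\<Sum>k | 1 \<le> k \<and> a k \<noteq> 0. a k * k) | a.
     (\<forall>k\<ge>1. a k \<le> \<omega> k) \<and> finite {k. 1 \<le> k \<and> a k \<noteq> 0}}"

end

(* A first moment bound in which each sample is weighted by 2^(-M_n), where M_n counts its points up
   to n. Typically M_n is about ln n, so each sample has about n^(ln 2) subset sums up to n. Since
   4 ln 2 < 3, four samples should share n with summable probability n^(4 ln 2 - 4). Atypically
   large M_n would spoil the plain first moment, and the weight suppresses them: the expected
   weighted number of representations of n is at most exp(-H_n/2) times the n-th coefficient
   of (1 - z)^(-1/2), hence at most 1/n. Borel-Cantelli makes the intersection of the four
   sumsets almost surely finite. Then, with positive probability, nothing beyond some N is common to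
   the sumsets generated by the points beyond N, and independently no sample has a point
   up to N. *)

theory Submission
  imports Defs
begin

section \<open>Weighted partitions and the coefficients of (1 - z)^(-x)\<close>

text \<open>The elements are the multiplicity vectors of the partitions of \<open>m\<close> into
  parts of size at most \<open>n\<close>. Being extensional, they are determined on
  \<open>{1..n}\<close>, which makes the set finite.\<close>

definition parts :: "nat \<Rightarrow> nat \<Rightarrow> (nat \<Rightarrow> nat) set" where
  "parts n m = {a \<in> {1..n} \<rightarrow>\<^sub>E UNIV. (\<Sum>k=1..n. a k * k) = m}"

text \<open>A product of Taylor coefficients of exp(x z^k / k), so that summation over
  \<open>parts n m\<close> yields the coefficient of z^m in exp(x (z + z^2/2 + ... +
  z^n/n)).\<close>

definition wt :: "real \<Rightarrow> nat \<Rightarrow> (nat \<Rightarrow> nat) \<Rightarrow> real" where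
  "wt x n a = (\<Prod>k=1..n. (x / real k) ^ a k / fact (a k))"

lemma parts_mult_le:
  assumes "a \<in> parts n m" "k \<in> {1..n}"
  shows "a k * k \<le> m"
proof -
  have "a k * k \<le> (\<Sum>k=1..n. a k * k)"
    by (rule member_le_sum) (use assms in auto)
  with assms show ?thesis by (auto simp: parts_def)
qed

lemma finite_parts [simp]: "finite (parts n m)"
proof (rule finite_subset)
  show "parts n m \<subseteq> {1..n} \<rightarrow>\<^sub>E {..m}"
  proof
    fix a assume a: "a \<in> parts n m"
    have "a k \<le> m" if "k \<in> {1..n}" for k
    proof -
      have "a k * 1 \<le> a k * k" using that by (intro mult_left_mono) auto
      also have "\<dots> \<le> m" using a that by (rule parts_mult_le)
      finally show ?thesis by simp
    qed
    then show "a \<in> {1..n} \<rightarrow>\<^sub>E {..m}" using a by (auto simp: parts_def PiE_iff)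
  qed
qed (auto intro: finite_PiE)

lemma parts_upd_Suc:
  assumes "k \<in> {1..n}"
  shows "a(k := Suc (a k)) \<in> parts n (m + k) \<longleftrightarrow> a \<in> parts n m"
proof -
  have "(\<Sum>i=1..n. (a(k := Suc (a k))) i * i) = (\<Sum>i=1..n. a i * i + (if i = k then k else 0))"
    by (intro sum.cong) auto
  also have "\<dots> = (\<Sum>i=1..n. a i * i) + k"
    using assms by (simp add: sum.distrib)
  finally have "(\<Sum>i=1..n. (a(k := Suc (a k))) i * i) = (\<Sum>i=1..n. a i * i) + k" .
  then show ?thesis
    using assms by (auto simp: parts_def PiE_iff extensional_def)
qed

text \<open>One more copy of \<open>k\<close> multiplies the weight by x / (k (a k + 1)). The
  identity is kept in the cleared form because the left factor is the contribution of
  \<open>k\<close> to the sum after the update.\<close>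

lemma wt_upd_Suc:
  assumes "k \<in> {1..n}"
  shows "real (Suc (a k) * k) * wt x n (a(k := Suc (a k))) = x * wt x n a"
proof -
  have "(\<Prod>i\<in>{1..n} - {k}. (x / real i) ^ (a(k := Suc (a k))) i / fact ((a(k := Suc (a k))) i))
      = (\<Prod>i\<in>{1..n} - {k}. (x / real i) ^ a i / fact (a i))"
    by (rule prod.cong) auto
  then show ?thesis
    using assms by (simp add: wt_def prod.remove[of _ k] field_simps del: fun_upd_apply)
      (simp add: field_simps)
qed

text \<open>Removing one copy of \<open>k\<close> is a bijection from the partitions of
  \<open>m\<close> that contain \<open>k\<close> to the partitions of \<open>m - k\<close>; the
  factor \<open>a k * k\<close> absorbs the change of weight. Partitions without \<open>k\<close>
  contribute 0.\<close>

lemma sum_parts_weighted: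
  assumes "k \<in> {1..n}"
  shows "(\<Sum>a\<in>parts n m. real (a k * k) * wt x n a)
     = (if k \<le> m then x * (\<Sum>a\<in>parts n (m - k). wt x n a) else 0)"
proof (cases "k \<le> m")
  case False
  have "a k = 0" if "a \<in> parts n m" for a
  proof (rule ccontr)
    assume "a k \<noteq> 0"
    then have "1 * k \<le> a k * k" by (intro mult_right_mono) auto
    with parts_mult_le[OF that assms] False show False by simp
  qed
  then show ?thesis using False by (simp add: sum.neutral)
next
  case True
  have "(\<Sum>a\<in>parts n m. real (a k * k) * wt x n a)
      = (\<Sum>a\<in>{a \<in> parts n m. a k \<noteq> 0}. real (a k * k) * wt x n a)"
    by (rule sum.mono_neutral_right) auto
  also have "\<dots> = (\<Sum>a\<in>parts n (m - k). x * wt x n a)"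
  proof (rule sum.reindex_bij_witness[of _ "\<lambda>a. a(k := Suc (a k))" "\<lambda>a. a(k := a k - 1)"])
    fix a assume a: "a \<in> {a \<in> parts n m. a k \<noteq> 0}"
    define b where "b = a(k := a k - 1)"
    have ab: "a = b(k := Suc (b k))" using a by (auto simp: b_def)
    show "b(k := Suc (b k)) = a" using ab by simp
    show "b \<in> parts n (m - k)"
      using parts_upd_Suc[OF assms, of b "m - k"] a ab True by simp
    show "x * wt x n b = real (a k * k) * wt x n a"
      using wt_upd_Suc[OF assms, of b x] ab by (metis fun_upd_same)
  next
    fix a assume "a \<in> parts n (m - k)"
    then show "a(k := Suc (a k)) \<in> {a \<in> parts n m. a k \<noteq> 0}"
      using parts_upd_Suc[OF assms, of a "m - k"] True by simp
  qed auto
  finally show ?thesis using True by (simp add: sum_distrib_left)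
qed

text \<open>This is the coefficient form of the logarithmic derivative of
  \<open>exp (x * (\<Sum>k. z^k / k)) = (1 - z) powr (- x)\<close>, obtained by inserting \<open>m = (\<Sum>k. a k * k)\<close>.\<close>

lemma sum_parts_rec:
  assumes "m \<le> n"
  shows "real m * (\<Sum>a\<in>parts n m. wt x n a) = x * (\<Sum>i<m. \<Sum>a\<in>parts n i. wt x n a)"
proof -
  have "real m * (\<Sum>a\<in>parts n m. wt x n a) = (\<Sum>a\<in>parts n m. \<Sum>k=1..n. real (a k * k) * wt x n a)"
    unfolding sum_distrib_left
    by (intro sum.cong refl) (simp add: parts_def flip: sum_distrib_right of_nat_sum of_nat_mult)
  also have "\<dots> = (\<Sum>k=1..n. \<Sum>a\<in>parts n m. real (a k * k) * wt x n a)"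
    by (rule sum.swap)
  also have "\<dots> = (\<Sum>k=1..n. if k \<le> m then x * (\<Sum>a\<in>parts n (m - k). wt x n a) else 0)"
    by (intro sum.cong refl sum_parts_weighted)
  \<comment> \<open>This is where \<open>m \<le> n\<close> enters: the truncation at
    \<open>n\<close> loses no part size up to \<open>m\<close>.\<close>
  also have "\<dots> = (\<Sum>k=1..m. x * (\<Sum>a\<in>parts n (m - k). wt x n a))"
    using assms by (intro sum.mono_neutral_cong_right) auto
  also have "\<dots> = (\<Sum>i<m. x * (\<Sum>a\<in>parts n i. wt x n a))"
    by (rule sum.reindex_bij_witness[of _ "\<lambda>i. m - i" "\<lambda>i. m - i"]) auto
  finally show ?thesis by (simp add: sum_distrib_left)
qed

lemma parts_0: "parts n 0 = {\<lambda>k\<in>{1..n}. 0}"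
  by (auto simp: parts_def PiE_iff extensional_def fun_eq_iff Ball_def split: if_splits)

text \<open>Subtracting consecutive instances of the recursion leaves (m + 1) c(m+1) = (m + x) c(m).
  The product is the coefficient of z^m in (1 - z)^(-x), written so that 1 - u \<le> exp(-u) applies
  to each factor.\<close>

lemma sum_parts_wt:
  assumes "m \<le> n"
  shows "(\<Sum>a\<in>parts n m. wt x n a) = (\<Prod>i=1..m. 1 - (1 - x) / real i)"
  using assms
proof (induction m)
  case 0
  show ?case by (simp add: parts_0 wt_def)
next
  case (Suc m)
  let ?c = "\<lambda>m. \<Sum>a\<in>parts n m. wt x n a"
  have "real (Suc m) * ?c (Suc m) = x * (\<Sum>i<m. ?c i) + x * ?c m"
    using sum_parts_rec[OF Suc.prems, of x] by (simp add: ring_distribs)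
  also have "\<dots> = (real m + x) * ?c m"
    using sum_parts_rec[of m n x] Suc.prems by (simp add: ring_distribs)
  finally have "?c (Suc m) = (1 - (1 - x) / real (Suc m)) * ?c m"
    by (simp add: field_simps)
  then show ?case using Suc by (simp add: mult.commute)
qed

lemma sum_parts_wt_le:
  "(\<Sum>a\<in>parts n n. wt (1/2) n a) \<le> exp (- harm n / 2)"
proof -
  have "(\<Sum>a\<in>parts n n. wt (1/2) n a) = (\<Prod>i=1..n. 1 - (1 - 1/2) / real i)"
    by (rule sum_parts_wt) simp
  also have "\<dots> \<le> (\<Prod>i=1..n. exp (- (1/2) / real i))"
  proof (intro prod_mono conjI)
    fix i assume i: "i \<in> {1..n}"
    show "0 \<le> 1 - (1 - 1/2) / real i" using i by (simp add: field_simps)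
    show "1 - (1 - 1/2) / real i \<le> exp (- (1/2) / real i)"
      using exp_ge_add_one_self[of "- (1/2) / real i"] by simp
  qed
  also have "\<dots> = exp (- harm n / 2)"
    by (simp add: exp_sum[symmetric] harm_def sum_divide_distrib sum_negf field_simps)
  finally show ?thesis .
qed

section \<open>Sumset membership as a finite condition\<close>

text \<open>A sum equal to \<open>n\<close> only uses integers up to \<open>n\<close>. Membership
  thus becomes a finite disjunction, which gives both measurability and the union bound over
  representations.\<close>

lemma sumset_iff_parts:
  assumes "1 \<le> n"
  shows "n \<in> sumset \<omega> \<longleftrightarrow> (\<exists>a\<in>parts n n. \<forall>k\<in>{1..n}. a k \<le> \<omega> k)"
proof
  assume "n \<in> sumset \<omega>"
  then obtain a where a: "n = (\<Sum>k | 1 \<le> k \<and> a k \<noteq> 0. a k * k)" "\<forall>k\<ge>1. a k \<le> \<omega> k"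
     "finite {k. 1 \<le> k \<and> a k \<noteq> 0}" by (auto simp: sumset_def)
  have "k \<le> n" if "1 \<le> k" "a k \<noteq> 0" for k
  proof -
    have "1 * k \<le> a k * k" using that by (intro mult_right_mono) auto
    also have "\<dots> \<le> n" unfolding a(1) by (rule member_le_sum) (use that a in auto)
    finally show ?thesis by simp
  qed
  then have "(\<Sum>k | 1 \<le> k \<and> a k \<noteq> 0. a k * k) = (\<Sum>k=1..n. a k * k)"
    by (intro sum.mono_neutral_left) auto
  then have "restrict a {1..n} \<in> parts n n" using a(1) by (auto simp: parts_def)
  then show "\<exists>a\<in>parts n n. \<forall>k\<in>{1..n}. a k \<le> \<omega> k"
    using a(2) by (intro bexI[of _ "restrict a {1..n}"]) auto
next
  assume "\<exists>a\<in>parts n n. \<forall>k\<in>{1..n}. a k \<le> \<omega> k"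
  then obtain a where a: "a \<in> parts n n" "\<And>k. k \<in> {1..n} \<Longrightarrow> a k \<le> \<omega> k" by auto
  \<comment> \<open>Outside \<open>{1..n}\<close> the extensional \<open>a\<close> is
    \<open>undefined\<close> rather than 0, so it has to be extended by 0.\<close>
  define b where "b k = (if k \<in> {1..n} then a k else 0)" for k
  have "(\<Sum>k | 1 \<le> k \<and> b k \<noteq> 0. b k * k) = (\<Sum>k=1..n. b k * k)"
    by (rule sum.mono_neutral_left) (auto simp: b_def)
  also have "\<dots> = n" using a(1) by (simp add: b_def parts_def)
  finally have "n = (\<Sum>k | 1 \<le> k \<and> b k \<noteq> 0. b k * k)" by simp
  moreover have "finite {k. 1 \<le> k \<and> b k \<noteq> 0}"
    by (rule finite_subset[of _ "{1..n}"]) (auto simp: b_def)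
  moreover have "\<forall>k\<ge>1. b k \<le> \<omega> k" using a(2) by (auto simp: b_def)
  ultimately show "n \<in> sumset \<omega>" unfolding sumset_def by blast
qed

section \<open>Generating functions of the Poisson distribution\<close>

lemma nn_integral_poisson_pmf:
  assumes "0 < l" "\<And>x. 0 \<le> f x" "(\<lambda>x. l ^ x / fact x * f x) sums s"
  shows "(\<integral>\<^sup>+x. ennreal (f x) \<partial>measure_pmf (poisson_pmf l)) = ennreal (exp (- l) * s)"
proof -
  have "(\<integral>\<^sup>+x. ennreal (f x) \<partial>measure_pmf (poisson_pmf l))
      = (\<Sum>x. ennreal (exp (- l) * (l ^ x / fact x * f x)))"
    unfolding nn_integral_measure_pmf nn_integral_count_space_nat
    using assms(1,2) by (simp add: mult_ac flip: ennreal_mult'')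
  also have "\<dots> = ennreal (exp (- l) * s)"
    using assms by (intro suminf_ennreal_eq sums_mult) auto
  finally show ?thesis .
qed

text \<open>Used with s \<ge> 1 for an exponential tail bound and with s = 0, where
  \<open>0 ^ x\<close> is the indicator of x = 0.\<close>

lemma poisson_pgf:
  assumes "0 < l" "0 \<le> s"
  shows "(\<integral>\<^sup>+x. ennreal (s ^ x) \<partial>measure_pmf (poisson_pmf l)) = ennreal (exp (l * (s - 1)))"
proof -
  have "(\<lambda>x. l ^ x / fact x * s ^ x) sums exp (l * s)"
    using exp_converges[of "l * s"] by (simp add: power_mult_distrib divide_inverse mult_ac)
  from nn_integral_poisson_pmf[OF assms(1) _ this] show ?thesis
    using assms by (simp add: algebra_simps flip: exp_add)
qed

text \<open>Shift the series by \<open>a\<close>: since x! a! \<le> (x + a)!, the term of order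
  \<open>a\<close> splits off and a full exponential series remains. For l = 1/k and s = 1/2 the
  last factor is the factor of \<open>wt (1/2)\<close> at \<open>k\<close>.\<close>

lemma poisson_pgf_tail_le:
  assumes "0 < l" "0 \<le> s"
  shows "(\<integral>\<^sup>+x. ennreal (if a \<le> x then s ^ x else 0) \<partial>measure_pmf (poisson_pmf l))
     \<le> ennreal (exp (l * (s - 1)) * ((l * s) ^ a / fact a))"
proof -
  let ?g = "\<lambda>x. l ^ x / fact x * (if a \<le> x then s ^ x else 0)"
  have conv: "(\<lambda>x. (l * s) ^ x / fact x) sums exp (l * s)"
    using exp_converges[of "l * s"] by (simp add: divide_inverse mult_ac)
  have shift: "?g (x + a) \<le> (l * s) ^ a / fact a * ((l * s) ^ x / fact x)" for x
  proof -
    have "fact x * fact a \<le> (fact (x + a) :: real)"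
      using fact_fact_dvd_fact[of x a, where 'a = nat]
      by (metis dvd_imp_le fact_gt_zero of_nat_fact of_nat_le_iff of_nat_mult)
    then have "(l * s) ^ (x + a) / fact (x + a) \<le> (l * s) ^ (x + a) / (fact x * fact a)"
      using assms by (intro divide_left_mono) auto
    then show ?thesis by (simp add: power_mult_distrib power_add mult_ac)
  qed
  have sm': "summable (\<lambda>x. ?g (x + a))"
  proof (rule summable_comparison_test')
    show "summable (\<lambda>x. (l * s) ^ a / fact a * ((l * s) ^ x / fact x))"
      using conv by (intro summable_mult sums_summable)
    show "norm (?g (x + a)) \<le> (l * s) ^ a / fact a * ((l * s) ^ x / fact x)" if "0 \<le> x" for x
      using shift[of x] assms by simp
  qed
  then have sm: "summable ?g" using summable_iff_shift[of ?g a] by simp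
  have "suminf ?g = (\<Sum>x. ?g (x + a)) + sum ?g {..<a}"
    by (rule suminf_split_initial_segment[OF sm])
  also have "sum ?g {..<a} = 0" by (intro sum.neutral) auto
  also have "(\<Sum>x. ?g (x + a)) \<le> (\<Sum>x. (l * s) ^ a / fact a * ((l * s) ^ x / fact x))"
    using shift sm' by (intro suminf_le summable_mult[OF sums_summable[OF conv]])
  also have "\<dots> = (l * s) ^ a / fact a * exp (l * s)"
    by (rule sums_unique[symmetric], rule sums_mult, rule conv)
  finally have le: "suminf ?g \<le> (l * s) ^ a / fact a * exp (l * s)" by simp
  have "(\<integral>\<^sup>+x. ennreal (if a \<le> x then s ^ x else 0) \<partial>measure_pmf (poisson_pmf l))
      = ennreal (exp (- l) * suminf ?g)"
    using assms sm by (intro nn_integral_poisson_pmf) auto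
  also have "\<dots> \<le> ennreal (exp (- l) * ((l * s) ^ a / fact a * exp (l * s)))"
    using le by (intro ennreal_leI mult_left_mono) auto
  also have "exp (- l) * ((l * s) ^ a / fact a * exp (l * s)) = exp (l * (s - 1)) * ((l * s) ^ a / fact a)"
    by (simp add: right_diff_distrib exp_diff exp_minus divide_inverse mult_ac)
  finally show ?thesis .
qed

section \<open>Harmonic numbers and elementary properties of sumsets\<close>

lemma harm_le_ln:
  assumes "1 \<le> n"
  shows "harm n \<le> 1 + ln (real n)"
proof -
  have "harm (Suc (n - 1)) - ln (real (Suc (n - 1))) \<le> harm (Suc 0) - ln (real (Suc 0))"
    using decseq_harm_diff_ln by (rule decseqD) simp
  then show ?thesis using assms by (simp add: harm_def)
qed

lemma sumset_mono:
  assumes "\<And>k. 1 \<le> k \<Longrightarrow> \<omega> k \<le> \<omega>' k"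
  shows "sumset \<omega> \<subseteq> sumset \<omega>'"
  unfolding sumset_def using assms order_trans by blast

lemma sumset_zero_below:
  assumes "n \<in> sumset \<omega>" "1 \<le> n" "\<And>k. 1 \<le> k \<Longrightarrow> k \<le> N \<Longrightarrow> \<omega> k = 0"
  shows "N < n"
proof (rule ccontr)
  assume *: "\<not> N < n"
  obtain a where a: "a \<in> parts n n" "\<And>k. k \<in> {1..n} \<Longrightarrow> a k \<le> \<omega> k"
    using assms(1,2) by (auto simp: sumset_iff_parts)
  have "(\<Sum>k=1..n. a k * k) = 0"
    using a(2) assms(3) * by (intro sum.neutral) fastforce
  with a(1) assms(2) show False by (simp add: parts_def)
qed

section \<open>Independent Poisson samples\<close>

text \<open>The set of samples is any finite \<open>R\<close>; the number four enters later, as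
  \<open>card R = 4\<close>.\<close>

locale poisson_samples = prob_space M for M :: "'a measure" +
  fixes R :: "nat set" and X :: "nat \<Rightarrow> nat \<Rightarrow> 'a \<Rightarrow> nat"
  assumes finite_R: "finite R"
    and indep: "indep_vars (\<lambda>_. count_space UNIV) (\<lambda>(r, k). X r k) (R \<times> {1..})"
    and distr_X: "\<And>r k. r \<in> R \<Longrightarrow> k \<ge> 1 \<Longrightarrow>
           distr M (count_space UNIV) (X r k) = measure_pmf (poisson_pmf (1 / real k))"
begin

lemma measurable_X [measurable]:
  "r \<in> R \<Longrightarrow> k \<ge> 1 \<Longrightarrow> X r k \<in> measurable M (count_space UNIV)"
  using indep unfolding indep_vars_def by auto

lemma measurable_prod:
  fixes f :: "nat \<Rightarrow> nat \<Rightarrow> nat \<Rightarrow> ennreal"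
  assumes "I \<subseteq> R \<times> {1..}"
  shows "(\<lambda>\<omega>. \<Prod>(r, k)\<in>I. f r k (X r k \<omega>)) \<in> borel_measurable M"
proof (intro borel_measurable_prod_ennreal)
  fix p assume "p \<in> I"
  then obtain r k where "p = (r, k)" "r \<in> R" "k \<ge> 1" using assms by auto
  then show "(\<lambda>\<omega>. case p of (r, k) \<Rightarrow> f r k (X r k \<omega>)) \<in> borel_measurable M" by simp
qed

text \<open>The form in which independence enters every moment computation. Values in
  \<open>ennreal\<close> spare all integrability conditions.\<close>

lemma nn_integral_prod:
  fixes f :: "nat \<Rightarrow> nat \<Rightarrow> nat \<Rightarrow> ennreal"
  assumes "finite I" "I \<subseteq> R \<times> {1..}"
  shows "(\<integral>\<^sup>+\<omega>. (\<Prod>(r, k)\<in>I. f r k (X r k \<omega>)) \<partial>M)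
     = (\<Prod>(r, k)\<in>I. \<integral>\<^sup>+x. f r k x \<partial>measure_pmf (poisson_pmf (1 / real k)))"
proof -
  have "indep_vars (\<lambda>_. borel) (\<lambda>p \<omega>. (case p of (r, k) \<Rightarrow> f r k) ((case p of (r, k) \<Rightarrow> X r k) \<omega>)) I"
    by (rule indep_vars_compose2[OF indep_vars_subset[OF indep assms(2)]]) auto
  then have "(\<integral>\<^sup>+\<omega>. (\<Prod>p\<in>I. (case p of (r, k) \<Rightarrow> f r k) ((case p of (r, k) \<Rightarrow> X r k) \<omega>)) \<partial>M)
      = (\<Prod>p\<in>I. \<integral>\<^sup>+\<omega>. (case p of (r, k) \<Rightarrow> f r k) ((case p of (r, k) \<Rightarrow> X r k) \<omega>) \<partial>M)"
    by (intro indep_vars_nn_integral assms(1)) auto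
  also have "\<dots> = (\<Prod>(r, k)\<in>I. \<integral>\<^sup>+x. f r k x \<partial>measure_pmf (poisson_pmf (1 / real k)))"
  proof (intro prod.cong refl, clarify)
    fix r k assume "(r, k) \<in> I"
    then have rk: "r \<in> R" "k \<ge> 1" using assms(2) by auto
    show "(\<integral>\<^sup>+\<omega>. f r k (X r k \<omega>) \<partial>M) = (\<integral>\<^sup>+x. f r k x \<partial>measure_pmf (poisson_pmf (1 / real k)))"
      using rk by (simp add: nn_integral_distr flip: distr_X)
  qed
  finally show ?thesis by (simp add: case_prod_unfold)
qed

section \<open>Point counts and the weighted first moment\<close>

definition count :: "nat \<Rightarrow> nat \<Rightarrow> 'a \<Rightarrow> nat" where
  "count r n \<omega> = (\<Sum>k=1..n. X r k \<omega>)"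

lemma measurable_count [measurable]:
  "r \<in> R \<Longrightarrow> count r n \<in> measurable M (count_space UNIV)"
  unfolding count_def by measurable

lemma measurable_sumset [measurable]:
  assumes "r \<in> R" "1 \<le> n"
  shows "Measurable.pred M (\<lambda>\<omega>. n \<in> sumset (\<lambda>k. X r k \<omega>))"
proof -
  have [measurable]: "countable (parts n n)" by (simp add: countable_finite)
  show ?thesis
    unfolding sumset_iff_parts[OF assms(2)] using assms(1) by measurable
qed

text \<open>Chernoff bound: s^(count - b) \<ge> 1 on the event, and s^count has expectation exp(H_n
  (s - 1)), because the count is a sum of independent Poisson variables of total mean H_n.\<close>

lemma count_tail:
  assumes r: "r \<in> R" and s: "1 \<le> s"
  shows "prob {\<omega> \<in> space M. b < real (count r n \<omega>)} \<le> s powr (- b) * exp (harm n * (s - 1))"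
proof -
  let ?A = "{\<omega> \<in> space M. b < real (count r n \<omega>)}"
  have "emeasure M ?A = (\<integral>\<^sup>+\<omega>. indicator ?A \<omega> \<partial>M)"
    using r by simp
  also have "\<dots> \<le> (\<integral>\<^sup>+\<omega>. ennreal (s powr (- b)) * ennreal (s ^ count r n \<omega>) \<partial>M)"
  proof (rule nn_integral_mono)
    fix \<omega>
    have "1 \<le> s powr (- b) * s ^ count r n \<omega>" if "b < real (count r n \<omega>)"
      using ge_one_powr_ge_zero[of s "real (count r n \<omega>) - b"] that s
      by (simp add: powr_realpow[symmetric] powr_minus powr_diff field_simps)
    then show "indicator ?A \<omega> \<le> ennreal (s powr (- b)) * ennreal (s ^ count r n \<omega>)"
      using s by (auto simp: indicator_def simp flip: ennreal_mult ennreal_1)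
  qed
  also have "\<dots> = ennreal (s powr (- b)) * (\<integral>\<^sup>+\<omega>. ennreal (s ^ count r n \<omega>) \<partial>M)"
    using r by (intro nn_integral_cmult) measurable
  also have "(\<lambda>\<omega>. ennreal (s ^ count r n \<omega>)) = (\<lambda>\<omega>. \<Prod>(r, k)\<in>{r} \<times> {1..n}. ennreal (s ^ X r k \<omega>))"
    using s by (simp add: count_def power_sum prod_ennreal flip: prod.cartesian_product)
  also have "(\<integral>\<^sup>+\<omega>. (\<Prod>(r, k)\<in>{r} \<times> {1..n}. ennreal (s ^ X r k \<omega>)) \<partial>M)
     = (\<Prod>(r, k)\<in>{r} \<times> {1..n}. \<integral>\<^sup>+x. ennreal (s ^ x) \<partial>measure_pmf (poisson_pmf (1 / real k)))"
    using r by (intro nn_integral_prod) auto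
  also have "\<dots> = ennreal (exp (harm n * (s - 1)))"
    using s by (simp add: poisson_pgf prod_ennreal harm_def sum_distrib_right divide_inverse
        flip: prod.cartesian_product exp_sum)
  finally show ?thesis
    using s by (simp add: emeasure_eq_measure flip: ennreal_mult)
qed

text \<open>On the event each sample dominates some partition of \<open>n\<close>, and 2^b
  2^(-count) \<ge> 1. So the indicator is at most the product over the samples of 2^b times the
  weighted number of representations, whose expectation is at most 1/n per sample.\<close>

lemma prob_sumset_le:
  assumes n: "1 \<le> n"
  shows "prob {\<omega> \<in> space M. \<forall>r\<in>R. n \<in> sumset (\<lambda>k. X r k \<omega>) \<and> real (count r n \<omega>) \<le> b}
     \<le> (2 powr b / real n) ^ card R"
proof -
  let ?A = "{\<omega> \<in> space M. \<forall>r\<in>R. n \<in> sumset (\<lambda>k. X r k \<omega>) \<and> real (count r n \<omega>) \<le> b}"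
  \<comment> \<open>The weight 2^(-count) is a product over \<open>k\<close>, so it is distributed
    over the single variables, next to the indicator of a \<le> x. \<open>F r\<close> is then the
    weighted number of representations of \<open>n\<close> in sample \<open>r\<close>.\<close>
  define f where "f a x = (if a \<le> x then (1/2) ^ x else 0 :: real)" for a x :: nat
  define F where "F r \<omega> = (\<Sum>a\<in>parts n n. \<Prod>k=1..n. ennreal (f (a k) (X r k \<omega>)))" for r \<omega>
  have F_meas: "(\<lambda>\<omega>. \<Prod>(r, k)\<in>R \<times> {1..n}. ennreal (f (g r k) (X r k \<omega>))) \<in> borel_measurable M" for g
    by (rule measurable_prod) auto
  have "?A \<in> events"
  proof (intro sets.sets_Collect_finite_All finite_R)
    fix r assume r: "r \<in> R"
    note [measurable] = measurable_sumset[OF r n] measurable_count[OF r]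
    show "{\<omega> \<in> space M. n \<in> sumset (\<lambda>k. X r k \<omega>) \<and> real (count r n \<omega>) \<le> b} \<in> events"
      by measurable
  qed
  then have "emeasure M ?A = (\<integral>\<^sup>+\<omega>. indicator ?A \<omega> \<partial>M)"
    by (rule nn_integral_indicator[symmetric])
  also have "\<dots> \<le> (\<integral>\<^sup>+\<omega>. (\<Prod>r\<in>R. ennreal (2 powr b) * F r \<omega>) \<partial>M)"
  proof (rule nn_integral_mono)
    fix \<omega>
    have "1 \<le> ennreal (2 powr b) * F r \<omega>" if "\<omega> \<in> ?A" "r \<in> R" for r
    proof -
      have "n \<in> sumset (\<lambda>k. X r k \<omega>)" and b: "real (count r n \<omega>) \<le> b" using that by auto
      then obtain a where a: "a \<in> parts n n" "\<And>k. k \<in> {1..n} \<Longrightarrow> a k \<le> X r k \<omega>"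
        using sumset_iff_parts[OF n] by auto
      have "ennreal ((1/2) ^ count r n \<omega>) = (\<Prod>k=1..n. ennreal (f (a k) (X r k \<omega>)))"
        using a(2) by (simp add: f_def count_def power_sum prod_ennreal)
      also have "\<dots> \<le> F r \<omega>"
        unfolding F_def using a(1) by (intro member_le_sum) auto
      finally have "ennreal (2 powr b) * ennreal ((1/2) ^ count r n \<omega>) \<le> ennreal (2 powr b) * F r \<omega>"
        by (rule mult_left_mono) simp
      moreover have "1 \<le> 2 powr b * (1/2) ^ count r n \<omega>"
        using b powr_mono[of "real (count r n \<omega>)" b 2]
        by (simp add: powr_realpow power_one_over field_simps)
      ultimately show ?thesis
        by (metis ennreal_1 ennreal_leI ennreal_mult' order_trans powr_ge_zero)
    qed
    then show "indicator ?A \<omega> \<le> (\<Prod>r\<in>R. ennreal (2 powr b) * F r \<omega>)"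
      using prod_mono_ennreal[of R "\<lambda>_. 1" "\<lambda>r. ennreal (2 powr b) * F r \<omega>"]
      by (auto simp: indicator_def)
  qed
  \<comment> \<open>Expand the product of sums: \<open>g\<close> picks one partition for each
    sample. Each summand is a single product over \<open>R \<times> {1..n}\<close>, to which
    independence applies.\<close>
  also have "(\<lambda>\<omega>. \<Prod>r\<in>R. ennreal (2 powr b) * F r \<omega>) = (\<lambda>\<omega>. \<Sum>g\<in>R \<rightarrow>\<^sub>E parts n n.
      ennreal (2 powr b) ^ card R * (\<Prod>(r, k)\<in>R \<times> {1..n}. ennreal (f (g r k) (X r k \<omega>))))"
  proof
    fix \<omega>
    have "(\<Prod>r\<in>R. ennreal (2 powr b) * F r \<omega>) = ennreal (2 powr b) ^ card R * (\<Prod>r\<in>R. F r \<omega>)"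
      unfolding prod.distrib prod_constant ..
    also have "(\<Prod>r\<in>R. F r \<omega>)
        = (\<Sum>g\<in>R \<rightarrow>\<^sub>E parts n n. \<Prod>r\<in>R. \<Prod>k=1..n. ennreal (f (g r k) (X r k \<omega>)))"
      unfolding F_def by (rule prod_sum_PiE[OF finite_R finite_parts])
    finally show "(\<Prod>r\<in>R. ennreal (2 powr b) * F r \<omega>) = (\<Sum>g\<in>R \<rightarrow>\<^sub>E parts n n.
      ennreal (2 powr b) ^ card R * (\<Prod>(r, k)\<in>R \<times> {1..n}. ennreal (f (g r k) (X r k \<omega>))))"
      by (simp only: prod.cartesian_product sum_distrib_left)
  qed
  also have "(\<integral>\<^sup>+\<omega>. (\<Sum>g\<in>R \<rightarrow>\<^sub>E parts n n. ennreal (2 powr b) ^ card R *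
        (\<Prod>(r, k)\<in>R \<times> {1..n}. ennreal (f (g r k) (X r k \<omega>)))) \<partial>M)
      = (\<Sum>g\<in>R \<rightarrow>\<^sub>E parts n n. \<integral>\<^sup>+\<omega>. ennreal (2 powr b) ^ card R *
        (\<Prod>(r, k)\<in>R \<times> {1..n}. ennreal (f (g r k) (X r k \<omega>))) \<partial>M)"
    using F_meas by (intro nn_integral_sum borel_measurable_times) auto
  also have "\<dots> = (\<Sum>g\<in>R \<rightarrow>\<^sub>E parts n n. ennreal (2 powr b) ^ card R *
        (\<integral>\<^sup>+\<omega>. (\<Prod>(r, k)\<in>R \<times> {1..n}. ennreal (f (g r k) (X r k \<omega>))) \<partial>M))"
    by (intro sum.cong refl nn_integral_cmult F_meas)
  also have "\<dots> = (\<Sum>g\<in>R \<rightarrow>\<^sub>E parts n n. ennreal (2 powr b) ^ card R *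
        (\<Prod>(r, k)\<in>R \<times> {1..n}. \<integral>\<^sup>+x. ennreal (f (g r k) x) \<partial>measure_pmf (poisson_pmf (1 / real k))))"
    using nn_integral_prod[where I = "R \<times> {1..n}" and f = "\<lambda>r k x. ennreal (f (_ r k) x)"] finite_R
    by (simp add: Sigma_mono)
  also have "\<dots> \<le> (\<Sum>g\<in>R \<rightarrow>\<^sub>E parts n n. ennreal (2 powr b) ^ card R *
        (\<Prod>(r, k)\<in>R \<times> {1..n}. ennreal (exp (- 1 / (2 * real k)) * ((1 / 2 / real k) ^ g r k / fact (g r k)))))"
  proof (intro sum_mono mult_left_mono prod_mono_ennreal, clarify)
    fix g :: "nat \<Rightarrow> nat \<Rightarrow> nat" and r k
    assume "k \<in> {1..n}"
    then have k: "0 < 1 / real k" by simp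
    have eq: "1 / real k * (1 / 2 - 1) = - 1 / (2 * real k)" "1 / real k * (1 / 2) = 1 / 2 / real k"
      by simp_all
    show "(\<integral>\<^sup>+x. ennreal (f (g r k) x) \<partial>measure_pmf (poisson_pmf (1 / real k)))
       \<le> ennreal (exp (- 1 / (2 * real k)) * ((1 / 2 / real k) ^ g r k / fact (g r k)))"
      using poisson_pgf_tail_le[OF k, of "1/2" "g r k"] unfolding f_def eq by simp
  qed auto
  \<comment> \<open>With the expectations bounded, the expansion over \<open>g\<close> is folded
    back into a product over samples.\<close>
  also have "\<dots> = ennreal (2 powr b) ^ card R * (\<Prod>r\<in>R. \<Sum>a\<in>parts n n. \<Prod>k=1..n.
        ennreal (exp (- 1 / (2 * real k)) * ((1 / 2 / real k) ^ a k / fact (a k))))"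
    unfolding prod_sum_PiE[OF finite_R finite_parts] prod.cartesian_product sum_distrib_left ..
  also have "(\<Sum>a\<in>parts n n. \<Prod>k=1..n.
        ennreal (exp (- 1 / (2 * real k)) * ((1 / 2 / real k) ^ a k / fact (a k))))
      = ennreal (exp (- harm n / 2) * (\<Sum>a\<in>parts n n. wt (1/2) n a))"
  proof -
    have "(\<Prod>k=1..n. exp (- 1 / (2 * real k)) * ((1 / 2 / real k) ^ a k / fact (a k)))
       = exp (- harm n / 2) * wt (1/2) n a" for a
    proof -
      have "(\<Prod>k=1..n. exp (- 1 / (2 * real k))) = exp (\<Sum>k=1..n. - 1 / (2 * real k))"
        by (simp add: exp_sum)
      also have "(\<Sum>k=1..n. - 1 / (2 * real k)) = - harm n / 2"
        unfolding harm_def sum_negf[symmetric] sum_divide_distrib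
        by (intro sum.cong) (auto simp: inverse_eq_divide)
      finally show ?thesis unfolding prod.distrib wt_def by (rule arg_cong)
    qed
    moreover have "0 \<le> wt (1/2) n a" for a by (simp add: wt_def prod_nonneg)
    ultimately show ?thesis by (simp add: prod_ennreal sum_distrib_left)
  qed
  also have "ennreal (2 powr b) ^ card R * (\<Prod>r\<in>R. ennreal (exp (- harm n / 2) * (\<Sum>a\<in>parts n n. wt (1/2) n a)))
     \<le> ennreal (2 powr b) ^ card R * (\<Prod>r\<in>R. ennreal (1 / real n))"
  proof (intro mult_left_mono prod_mono_ennreal ennreal_leI)
    \<comment> \<open>One factor exp(-H_n/2) comes from the Poisson generating functions at s = 1/2,
      the other from the coefficient of (1 - z)^(-1/2).\<close>
    have "exp (- harm n / 2) * (\<Sum>a\<in>parts n n. wt (1/2) n a) \<le> exp (- harm n / 2) * exp (- harm n / 2)"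
      by (intro mult_left_mono sum_parts_wt_le) simp
    also have "\<dots> = exp (- harm n)" by (simp flip: exp_add)
    also have "\<dots> \<le> exp (- ln (real n + 1))" using ln_le_harm[of n] by simp
    also have "\<dots> \<le> 1 / real n" using n by (simp add: exp_minus field_simps)
    finally show "exp (- harm n / 2) * (\<Sum>a\<in>parts n n. wt (1/2) n a) \<le> 1 / real n" .
  qed auto
  also have "\<dots> = ennreal ((2 powr b / real n) ^ card R)"
  proof -
    have "ennreal (2 powr b) ^ card R * (\<Prod>r\<in>R. ennreal (1 / real n))
        = ennreal ((2 powr b) ^ card R) * ennreal ((1 / real n) ^ card R)"
      by (simp only: prod_constant ennreal_power powr_ge_zero zero_le_divide_1_iff of_nat_0_le_iff)
    also have "\<dots> = ennreal ((2 powr b) ^ card R * (1 / real n) ^ card R)"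
      by (rule ennreal_mult[symmetric]) auto
    finally show ?thesis by (simp add: power_divide)
  qed
  finally show ?thesis by (simp add: emeasure_eq_measure)
qed

section \<open>Almost sure finiteness of the intersection\<close>

lemma count_mono: "m \<le> n \<Longrightarrow> count r m \<omega> \<le> count r n \<omega>"
  unfolding count_def by (intro sum_mono2) auto

text \<open>For t near 1 the tail bound at \<open>n\<close> is a small negative power of
  \<open>n\<close>, not summable over all \<open>n\<close> but summable along powers of two.
  Monotonicity of the count fills the gaps; rounding \<open>n\<close> up to a power of two at most
  2n costs the factor 2 inside the logarithm.\<close>

lemma AE_count_le:
  assumes r: "r \<in> R" and t: "1 < t"
  shows "AE \<omega> in M. \<forall>\<^sub>F n in sequentially. real (count r n \<omega>) \<le> t * ln (2 * real n)"
proof -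
  define A where "A j = {\<omega> \<in> space M. t * ln (2 ^ j) < real (count r (2 ^ j) \<omega>)}" for j :: nat
  \<comment> \<open>The Chernoff bound with s = t, the optimal choice for threshold t ln(2^j) and
    mean about ln(2^j), is a constant times q^j.\<close>
  define q where "q = exp (ln 2 * (t - 1 - t * ln t))"
  \<comment> \<open>Strictness of ln u \<le> u - 1 away from u = 1 is what makes q < 1.\<close>
  have "ln (1 / t) < 1 / t - 1"
    using t ln_le_minus_one[of "1 / t"] ln_eq_minus_one[of "1 / t"] by (fastforce simp: less_le)
  then have "t - 1 < t * ln t" using t by (simp add: ln_div field_simps)
  then have q: "0 < q" "q < 1" by (simp_all add: q_def mult_pos_neg)
  have le: "prob (A j) \<le> exp (t - 1) * q ^ j" for j
  proof -
    have "prob (A j) \<le> t powr (- (t * ln (2 ^ j))) * exp (harm (2 ^ j) * (t - 1))"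
      unfolding A_def using count_tail[OF r, of t] t by simp
    also have "\<dots> \<le> t powr (- (t * ln (2 ^ j))) * exp ((1 + ln (2 ^ j)) * (t - 1))"
      using harm_le_ln[of "2 ^ j"] t by (intro mult_left_mono) auto
    also have "\<dots> = exp (t - 1) * q ^ j"
      using t by (simp add: q_def powr_def ln_realpow algebra_simps flip: exp_add exp_of_nat_mult)
    finally show ?thesis .
  qed
  have "summable (\<lambda>j. prob (A j))"
  proof (rule summable_comparison_test')
    show "summable (\<lambda>j. exp (t - 1) * q ^ j)" using q by (intro summable_mult summable_geometric) auto
    show "norm (prob (A j)) \<le> exp (t - 1) * q ^ j" if "0 \<le> j" for j using le by simp
  qed
  then have "AE \<omega> in M. \<forall>\<^sub>F j in sequentially. \<omega> \<in> space M - A j"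
    using r by (intro borel_cantelli_AE1) (auto simp: A_def emeasure_eq_measure)
  then show ?thesis
  proof eventually_elim
    case (elim \<omega>)
    then obtain J where J: "\<And>j. J \<le> j \<Longrightarrow> \<omega> \<in> space M - A j"
      by (auto simp: eventually_sequentially)
    have "real (count r n \<omega>) \<le> t * ln (2 * real n)" if n: "2 ^ J \<le> n" for n
    proof -
      have "1 \<le> n" using n one_le_power[of "2::nat" J] by linarith
      then obtain j where j: "2 ^ j \<le> n" "n < 2 ^ (j + 1)"
        using ex_power_ivl1[of 2 n] by auto
      have "(2::nat) ^ J < 2 ^ (j + 1)" using j n by linarith
      then have "J \<le> j + 1" using power_less_imp_less_exp[of "2::nat" J "j + 1"] by simp
      have "real (count r n \<omega>) \<le> real (count r (2 ^ (j + 1)) \<omega>)"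
        using j by (intro of_nat_mono count_mono) auto
      also have "\<dots> \<le> t * ln (2 ^ (j + 1))"
        using J[OF \<open>J \<le> j + 1\<close>] by (simp add: A_def not_less)
      also have "\<dots> \<le> t * ln (2 * real n)"
      proof -
        have "2 * 2 ^ j \<le> 2 * real n" using j(1) by (metis mult_left_mono numeral_power_le_of_nat_cancel_iff zero_le_numeral)
        then show ?thesis using t \<open>1 \<le> n\<close> by simp
      qed
      finally show ?thesis .
    qed
    then show ?case unfolding eventually_sequentially by blast
  qed
qed

text \<open>Two applications of Borel-Cantelli: almost surely all counts are eventually at most t
  ln(2n), and only finitely many \<open>n\<close> are common to the sumsets while obeying this
  bound.\<close>

lemma AE_sumset_Inter_bounded:
  assumes "card R = 4"
  shows "AE \<omega> in M. \<exists>N. \<forall>n>N. \<exists>r\<in>R. n \<notin> sumset (\<lambda>k. X r k \<omega>)"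
proof -
  \<comment> \<open>Any \<open>t > 1\<close> with \<open>4 * t * ln 2 < 3\<close> would do.\<close>
  define t :: real where "t = 107 / 100"
  \<comment> \<open>The guard \<open>1 \<le> n\<close> makes \<open>A 0\<close> empty; 0 lies in
    every sumset as the empty sum.\<close>
  define A where "A n = {\<omega> \<in> space M. 1 \<le> n \<and>
     (\<forall>r\<in>R. n \<in> sumset (\<lambda>k. X r k \<omega>) \<and> real (count r n \<omega>) \<le> t * ln (2 * real n))}" for n
  define C :: real where "C = 2 powr (4 * t * ln 2)"
  have [measurable]: "A n \<in> events" for n
  proof (cases "1 \<le> n")
    case True
    then show ?thesis unfolding A_def using finite_R by measurable
  qed (simp add: A_def)
  have le: "prob (A n) \<le> C * real n powr (4 * t * ln 2 - 4)" for n
  proof (cases "1 \<le> n")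
    case True
    have "prob (A n) \<le> (2 powr (t * ln (2 * real n)) / real n) ^ 4"
      unfolding A_def using prob_sumset_le[OF True, of "t * ln (2 * real n)"] True assms by simp
    also have "2 powr (t * ln (2 * real n)) = (2 * real n) powr (t * ln 2)"
      using True by (simp add: powr_def)
    also have "((2 * real n) powr (t * ln 2) / real n) ^ 4 = (2 * real n) powr (4 * (t * ln 2)) / real n ^ 4"
      using True by (simp add: power_divide powr_power mult.commute)
    also have "\<dots> = C * real n powr (4 * t * ln 2 - 4)"
      using True by (simp add: C_def powr_mult powr_diff powr_realpow mult.assoc)
    finally show ?thesis .
  qed (simp add: A_def C_def)
  have "summable (\<lambda>n. prob (A n))"
  proof (rule summable_comparison_test')
    \<comment> \<open>The exponent must be below -1, that is 4 t ln 2 < 3; with ln 2 \<le> 25/36 the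
      left side is at most 107/36 < 108/36.\<close>
    show "summable (\<lambda>n. C * real n powr (4 * t * ln 2 - 4))"
      using ln2_le_25_over_36 by (intro summable_mult) (simp add: summable_real_powr_iff t_def)
    show "norm (prob (A n)) \<le> C * real n powr (4 * t * ln 2 - 4)" if "0 \<le> n" for n using le by simp
  qed
  then have "AE \<omega> in M. \<forall>\<^sub>F n in sequentially. \<omega> \<in> space M - A n"
    by (intro borel_cantelli_AE1) (auto simp: emeasure_eq_measure)
  moreover have "AE \<omega> in M. \<forall>r\<in>R. \<forall>\<^sub>F n in sequentially. real (count r n \<omega>) \<le> t * ln (2 * real n)"
    using finite_R by (intro AE_finite_allI AE_count_le) (auto simp: t_def)
  ultimately show ?thesis
  proof eventually_elim
    case (elim \<omega>)
    have "\<forall>\<^sub>F n in sequentially. \<forall>r\<in>R. real (count r n \<omega>) \<le> t * ln (2 * real n)"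
      using elim(2) finite_R by (simp add: eventually_ball_finite)
    with elim(1) have "\<forall>\<^sub>F n in sequentially. 1 \<le> n \<longrightarrow> (\<exists>r\<in>R. n \<notin> sumset (\<lambda>k. X r k \<omega>))"
      by eventually_elim (auto simp: A_def)
    then obtain N where "\<And>n. N \<le> n \<Longrightarrow> 1 \<le> n \<longrightarrow> (\<exists>r\<in>R. n \<notin> sumset (\<lambda>k. X r k \<omega>))"
      by (auto simp: eventually_sequentially)
    then show ?case by (intro exI[of _ N]) auto
  qed
qed

section \<open>Positive probability of an empty intersection\<close>

text \<open>The indicator of X = 0 is \<open>0 ^ X\<close>, so the probability is a finite product
  of generating functions at 0, each equal to exp(-1/k) > 0.\<close>

lemma prob_zero_below_pos: "0 < prob {\<omega> \<in> space M. \<forall>(r, k)\<in>R \<times> {1..N}. X r k \<omega> = 0}"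
proof -
  let ?A = "{\<omega> \<in> space M. \<forall>(r, k)\<in>R \<times> {1..N}. X r k \<omega> = 0}"
  have "?A \<in> events"
  proof (intro sets.sets_Collect_finite_All)
    fix p assume "p \<in> R \<times> {1..N}"
    then obtain r k where "p = (r, k)" "r \<in> R" "k \<ge> 1" by auto
    then show "{\<omega> \<in> space M. case p of (r, k) \<Rightarrow> X r k \<omega> = 0} \<in> events" by simp
  qed (use finite_R in auto)
  then have "emeasure M ?A = (\<integral>\<^sup>+\<omega>. indicator ?A \<omega> \<partial>M)" by simp
  also have "\<dots> = (\<integral>\<^sup>+\<omega>. (\<Prod>(r, k)\<in>R \<times> {1..N}. ennreal (0 ^ X r k \<omega>)) \<partial>M)"
  proof (intro nn_integral_cong)
    fix \<omega> assume "\<omega> \<in> space M"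
    then show "indicator ?A \<omega> = (\<Prod>(r, k)\<in>R \<times> {1..N}. ennreal (0 ^ X r k \<omega>))"
      using finite_R by (auto simp: indicator_def intro!: prod.neutral prod_zero[symmetric])
  qed
  also have "\<dots> = (\<Prod>(r, k)\<in>R \<times> {1..N}. \<integral>\<^sup>+x. ennreal (0 ^ x) \<partial>measure_pmf (poisson_pmf (1 / real k)))"
    using finite_R by (intro nn_integral_prod) auto
  also have "\<dots> = (\<Prod>(r, k)\<in>R \<times> {1..N}. ennreal (exp (- 1 / real k)))"
    using poisson_pgf[of "1 / real _" 0] by (intro prod.cong) auto
  also have "\<dots> = ennreal (\<Prod>(r, k)\<in>R \<times> {1..N}. exp (- 1 / real k))"
    by (simp add: case_prod_unfold prod_ennreal)
  finally have "prob ?A = (\<Prod>(r, k)\<in>R \<times> {1..N}. exp (- 1 / real k))"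
    by (simp add: emeasure_eq_measure prod_nonneg case_prod_unfold)
  then show ?thesis by (simp add: prod_pos case_prod_unfold)
qed

text \<open>The event \<open>B N\<close> also depends on the points up to \<open>N\<close>. It is
  enlarged to an event about the points beyond \<open>N\<close> only, which is independent of there
  being no points up to \<open>N\<close>; when there are none, the two agree.\<close>

lemma prob_sumset_Inter_empty_pos:
  assumes "card R = 4"
  shows "0 < prob {\<omega> \<in> space M. \<forall>n\<ge>1. \<exists>r\<in>R. n \<notin> sumset (\<lambda>k. X r k \<omega>)}"
proof -
  define B where "B N = {\<omega> \<in> space M. \<forall>n>N. \<exists>r\<in>R. n \<notin> sumset (\<lambda>k. X r k \<omega>)}" for N
  have [measurable]: "B N \<in> events" for N
  proof -
    have *: "B N = {\<omega> \<in> space M. \<forall>n\<in>{N<..}. \<exists>r\<in>R. n \<notin> sumset (\<lambda>k. X r k \<omega>)}"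
      by (auto simp: B_def)
    have [measurable]: "countable R" "countable {N<..}" using finite_R by (auto simp: countable_finite)
    show ?thesis unfolding * by measurable
  qed
  \<comment> \<open>If every \<open>B N\<close> were null, so would be their countable union, which
    has full measure.\<close>
  obtain N where N: "prob (B N) \<noteq> 0"
  proof (rule ccontr)
    assume "\<not> thesis"
    with that have "prob (B N) = 0" for N by blast
    then have "AE \<omega> in M. \<forall>N. \<omega> \<notin> B N"
      unfolding AE_all_countable by (intro allI AE_not_in) (auto simp: null_sets_def emeasure_eq_measure)
    with AE_sumset_Inter_bounded[OF assms] AE_space have "AE \<omega> in M. False"
      by eventually_elim (unfold B_def, blast)
    then show False by simp
  qed
  define I where "I = R \<times> {1..N}"
  define J where "J = R \<times> {N<..}"
  define M' where "M' = (\<lambda>_ :: nat \<times> nat. count_space (UNIV :: nat set))"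
  define U where "U = {x \<in> space (PiM I M'). \<forall>p\<in>I. x p = 0}"
  \<comment> \<open>Putting 0 in place of the coordinates up to \<open>N\<close> makes this a set in
    the product over \<open>J\<close>, where independence of disjoint coordinate blocks
    applies.\<close>
  define V where "V = {x \<in> space (PiM J M'). \<forall>n\<in>{N<..}. \<exists>r\<in>R. n \<notin> sumset (\<lambda>k. if k \<le> N then 0 else x (r, k))}"
  define Y where "Y K \<omega> = restrict (\<lambda>p. (case p of (r, k) \<Rightarrow> X r k) \<omega>) K" for K \<omega>
  have "finite I" using finite_R by (simp add: I_def)
  have U [measurable]: "U \<in> sets (PiM I M')"
  proof -
    have [measurable]: "(\<lambda>x. x p) \<in> measurable (PiM I M') (count_space UNIV)" if "p \<in> I" for p
      using measurable_component_singleton[OF that, of M'] by (simp add: M'_def)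
    show ?thesis unfolding U_def using \<open>finite I\<close> by measurable
  qed
  have V [measurable]: "V \<in> sets (PiM J M')"
  proof -
    have comp [measurable]: "(\<lambda>x. if k \<le> N then 0 else x (r, k)) \<in> measurable (PiM J M') (count_space UNIV)" if "r \<in> R" for r k
    proof (cases "k \<le> N")
      case False
      then have "(r, k) \<in> J" using that by (auto simp: J_def)
      from measurable_component_singleton[OF this, of M'] False show ?thesis by (simp add: M'_def)
    qed simp
    have [measurable]: "Measurable.pred (PiM J M') (\<lambda>x. n \<in> sumset (\<lambda>k. if k \<le> N then 0 else x (r, k)))"
      if "r \<in> R" "n \<in> {N<..}" for r n
    proof -
      have [measurable]: "countable (parts n n)" by (simp add: countable_finite)
      have "1 \<le> n" using that by simp
      show ?thesis unfolding sumset_iff_parts[OF \<open>1 \<le> n\<close>] using that(1) by measurable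
    qed
    have [measurable]: "countable R" "countable {N<..}" using finite_R by (auto simp: countable_finite)
    show ?thesis unfolding V_def by measurable
  qed
  have indep_Y: "indep_var (PiM I M') (Y I) (PiM J M') (Y J)"
    unfolding Y_def [abs_def] using indep
    by (intro indep_var_restrict[where I = "R \<times> {1..}"]) (auto simp: I_def J_def M'_def)
  note ind = indep_varD[OF indep_Y U V]
  have Y_in: "Y I \<omega> \<in> space (PiM I M')" "Y J \<omega> \<in> space (PiM J M')" for \<omega>
    by (simp_all add: Y_def space_PiM M'_def)
  have I_eq: "Y I -` U \<inter> space M = {\<omega> \<in> space M. \<forall>(r, k)\<in>R \<times> {1..N}. X r k \<omega> = 0}"
    using Y_in(1) by (auto simp: U_def I_def Y_def)
  have V_eq: "Y J \<omega> \<in> V \<longleftrightarrow> (\<forall>n\<in>{N<..}. \<exists>r\<in>R. n \<notin> sumset (\<lambda>k. if k \<le> N then 0 else X r k \<omega>))" for \<omega>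
  proof -
    have "(\<lambda>k. if k \<le> N then 0 else Y J \<omega> (r, k)) = (\<lambda>k. if k \<le> N then 0 else X r k \<omega>)" if "r \<in> R" for r
      using that by (auto simp: Y_def J_def)
    then show ?thesis using Y_in(2) by (simp add: V_def cong: bex_cong)
  qed
  have sub: "sumset (\<lambda>k. if k \<le> N then 0 else X r k \<omega>) \<subseteq> sumset (\<lambda>k. X r k \<omega>)" for r \<omega>
    by (rule sumset_mono) auto
  \<comment> \<open>Deleting the points up to \<open>N\<close> shrinks every sumset, so fewer
    integers are common.\<close>
  have "B N \<subseteq> Y J -` V \<inter> space M"
    using sub by (fastforce simp: B_def V_eq)
  moreover have "Y J -` V \<inter> space M \<in> events"
    using indep_var_rv2[OF indep_Y] V by (rule measurable_sets)
  ultimately have "0 < prob (Y J -` V \<inter> space M)"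
    using N finite_measure_mono[of "B N" "Y J -` V \<inter> space M"] measure_nonneg[of M "B N"] by linarith
  with prob_zero_below_pos[of N] ind
  have "0 < prob ((\<lambda>\<omega>. (Y I \<omega>, Y J \<omega>)) -` (U \<times> V) \<inter> space M)"
    by (simp add: I_eq)
  also have "\<dots> \<le> prob {\<omega> \<in> space M. \<forall>n\<ge>1. \<exists>r\<in>R. n \<notin> sumset (\<lambda>k. X r k \<omega>)}"
  proof (rule finite_measure_mono)
    show "{\<omega> \<in> space M. \<forall>n\<ge>1. \<exists>r\<in>R. n \<notin> sumset (\<lambda>k. X r k \<omega>)} \<in> events"
    proof -
      have "{\<omega> \<in> space M. \<forall>n\<ge>1. \<exists>r\<in>R. n \<notin> sumset (\<lambda>k. X r k \<omega>)} = B 0"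
        by (auto simp: B_def Suc_le_eq)
      then show ?thesis by simp
    qed
    show "(\<lambda>\<omega>. (Y I \<omega>, Y J \<omega>)) -` (U \<times> V) \<inter> space M
       \<subseteq> {\<omega> \<in> space M. \<forall>n\<ge>1. \<exists>r\<in>R. n \<notin> sumset (\<lambda>k. X r k \<omega>)}"
    proof
      fix \<omega> assume "\<omega> \<in> (\<lambda>\<omega>. (Y I \<omega>, Y J \<omega>)) -` (U \<times> V) \<inter> space M"
      then have \<omega>: "\<omega> \<in> space M" "Y I \<omega> \<in> U" "Y J \<omega> \<in> V" by auto
      have "\<omega> \<in> Y I -` U \<inter> space M" using \<omega> by blast
      then have zero: "X r k \<omega> = 0" if "r \<in> R" "1 \<le> k" "k \<le> N" for r k
        unfolding I_eq using that by auto
      have "\<exists>r\<in>R. n \<notin> sumset (\<lambda>k. X r k \<omega>)" if n: "1 \<le> n" for n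
      proof (rule ccontr)
        assume "\<not> (\<exists>r\<in>R. n \<notin> sumset (\<lambda>k. X r k \<omega>))"
        then have all: "n \<in> sumset (\<lambda>k. X r k \<omega>)" if "r \<in> R" for r using that by blast
        obtain r0 where "r0 \<in> R" using assms by fastforce
        \<comment> \<open>A single sample suffices to force \<open>n\<close> beyond
          \<open>N\<close>, and \<open>card R = 4\<close> provides one.\<close>
        then have "N < n" using all zero n by (intro sumset_zero_below[of n "\<lambda>k. X r0 k \<omega>"])
        then obtain r where r: "r \<in> R" "n \<notin> sumset (\<lambda>k. if k \<le> N then 0 else X r k \<omega>)"
          using \<omega>(3) unfolding V_eq by auto
        \<comment> \<open>With no points up to \<open>N\<close>, deleting them changes nothing, so
          the sumset of the sample is that of its tail.\<close>
        have "sumset (\<lambda>k. X r k \<omega>) \<subseteq> sumset (\<lambda>k. if k \<le> N then 0 else X r k \<omega>)"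
          using zero[OF r(1)] by (intro sumset_mono) auto
        with all[OF r(1)] r(2) show False by blast
      qed
      with \<omega>(1) show "\<omega> \<in> {\<omega> \<in> space M. \<forall>n\<ge>1. \<exists>r\<in>R. n \<notin> sumset (\<lambda>k. X r k \<omega>)}" by blast
    qed
  qed
  finally show ?thesis .
qed

end

theorem theorem1p6:
  fixes M :: "'a measure" and X :: "nat \<Rightarrow> nat \<Rightarrow> 'a \<Rightarrow> nat"
  assumes "prob_space M"
    and "prob_space.indep_vars M (\<lambda>_. count_space UNIV) (\<lambda>(r, k). X r k) ({1..4} \<times> {1..})"
    and "\<And>r k. r \<in> {1..4} \<Longrightarrow> k \<ge> 1 \<Longrightarrow>
           distr M (count_space UNIV) (X r k) = measure_pmf (poisson_pmf (1 / real k))"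
  shows "{w \<in> space M. \<not> (\<exists>n\<ge>1. n \<in> (\<Inter>r\<in>{1..4}. sumset (\<lambda>k. X r k w)))} \<in> sets M
       \<and> measure M {w \<in> space M. \<not> (\<exists>n\<ge>1. n \<in> (\<Inter>r\<in>{1..4}. sumset (\<lambda>k. X r k w)))} > 0"
proof -
  interpret prob_space M by fact
  interpret poisson_samples M "{1..4}" X
    using assms by unfold_locales auto
  have "{w \<in> space M. \<not> (\<exists>n\<ge>1. n \<in> (\<Inter>r\<in>{1..4}. sumset (\<lambda>k. X r k w)))}
      = {w \<in> space M. \<forall>n\<ge>1. \<exists>r\<in>{1..4}. n \<notin> sumset (\<lambda>k. X r k w)}" by auto
  then have "0 < prob {w \<in> space M. \<not> (\<exists>n\<ge>1. n \<in> (\<Inter>r\<in>{1..4}. sumset (\<lambda>k. X r k w)))}"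
    using prob_sumset_Inter_empty_pos by simp
  then show ?thesis
    \<comment> \<open>A nonmeasurable set has \<open>measure\<close> 0 by default, so positivity
      already implies measurability.\<close>
    using measure_notin_sets by fastforce
qed

end
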